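(* For $n\in\mathbb{N}=\{1,2,\dotsc\}$ let $$\mathcal{L}_n=\sum_{k=1}^{n}L(n,k)$$ be the total sum of Lah numbers. Then the sequence $(\mathcal{L}_n)_{n\in\mathbb{N}}$ is absolutely convex. In particular, the sequence $(\mathcal{L}_n)_{n\in\mathbb{N}}$ is convex, i.e. $\mathcal{L}_{n+2}-2\mathcal{L}_{n+1}+\mathcal{L}_n\ge0$ for all $n\in\mathbb{N}$.
   Context: For integers $1\le k\le n$, the Lah number $L(n,k)$ is the number of ways a set of $n$ elements can be partitioned into $k$ nonempty linearly ordered subsets; explicitly, $L(n,k)=\binom{n-1}{k-1}\frac{n!}{k!}$. A real sequence $(\mu_n)$ is called absolutely convex if all its elements are non-negative and its successive differences satisfy $\Delta^{2k}\mu_n\ge0$ for all integers $k\ge0$ and all indices $n$ of the sequence, where $$\Delta^k\mu_n=\sum_{m=0}^k(-1)^m\binom{k}{m}\mu_{n+k-m}.$$ Here the sequence is indexed by $n\ge1$. *)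

theory Defs
  imports Complex_Main "HOL-Library.Disjoint_Sets"
begin

text \<open>
  A linearly ordered finite block is encoded as the duplicate-free list of its elements in
  increasing order. The condition \<^term>\<open>inj_on set P\<close> says that every block carries exactly one
  order, so that \<^term>\<open>card P\<close> is the number of blocks; nonemptiness of the blocks is part of
  \<^const>\<open>partition_on\<close>.
\<close>

definition ordered_block_partitions :: "'a set \<Rightarrow> nat \<Rightarrow> 'a list set set" where
  "ordered_block_partitions A k =
     {P. (\<forall>xs\<in>P. distinct xs) \<and> inj_on set P \<and> partition_on A (set ` P) \<and> card P = k}"

definition lah :: "nat \<Rightarrow> nat \<Rightarrow> nat" where
  "lah n k = card (ordered_block_partitions {1..n} k)"

definition lah_total :: "nat \<Rightarrow> nat" where
  "lah_total n = (\<Sum>k=1..n. lah n k)"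

definition seq_diff :: "nat \<Rightarrow> (nat \<Rightarrow> real) \<Rightarrow> nat \<Rightarrow> real" where
  "seq_diff k \<mu> n = (\<Sum>m=0..k. (-1) ^ m * real (k choose m) * \<mu> (n + k - m))"

text \<open>Sequences are indexed by the positive integers; the value at \<open>0\<close> plays no role.\<close>

definition absolutely_convex :: "(nat \<Rightarrow> real) \<Rightarrow> bool" where
  "absolutely_convex \<mu> \<longleftrightarrow>
     (\<forall>n\<ge>1. \<mu> n \<ge> 0) \<and> (\<forall>k. \<forall>n\<ge>1. seq_diff (2 * k) \<mu> n \<ge> 0)"

end

theory Submission
  imports Defs
begin

text \<open>
  The differences of the sequence are cardinalities. Partitions of an \<open>N\<close>-element set into
  linearly ordered blocks in which a prescribed element is a block of its own correspond to the
  partitions of the remaining \<open>N - 1\<close> elements. Hence, by inclusion-exclusion, for \<open>n \<ge> 1\<close> the number of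
  partitions of an \<open>(n + k)\<close>-element set \<open>A\<close> in which no element of a fixed \<open>k\<close>-element subset
  \<open>B\<close> forms a singleton block is
  \<open>\<Sum>m=0..k. (-1) ^ m * (k choose m) * lah_total (n + k - m)\<close>, which is the \<open>k\<close>-th difference at \<open>n\<close>.
  So every difference, of odd order as well as of even order, counts something and is
  non-negative. (In terms of exponential generating functions, with the empty partition counted
  and all elements in \<open>B\<close>: multiplying
  \<open>exp (x / (1 - x))\<close> by \<open>exp (- x)\<close> gives \<open>exp (x\<^sup>2 / (1 - x))\<close>, that is, it removes the
  singleton blocks.)

  The inclusion-exclusion is carried out one element of \<open>B\<close> at a time, in
  \<open>card_no_singletons_insert\<close>, which matches the Pascal-type recursion \<open>seq_diff_Suc\<close> of the
  differences; \<open>card_no_singletons_eq_seq_diff\<close> puts the two together.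
\<close>

section \<open>Partitions into linearly ordered blocks\<close>

definition list_partitions :: "'a set \<Rightarrow> 'a list set set" where
  "list_partitions A =
     {P. (\<forall>xs\<in>P. distinct xs) \<and> inj_on set P \<and> partition_on A (set ` P)}"

text \<open>
  Two nonempty blocks with the same elements are never disjoint, so injectivity of \<^const>\<open>set\<close>
  is absorbed by the requirement that distinct lists have disjoint element sets.
\<close>
lemma list_partitions_iff:
  "P \<in> list_partitions A \<longleftrightarrow>
     (\<forall>xs\<in>P. distinct xs \<and> xs \<noteq> []) \<and>
     (\<forall>xs\<in>P. \<forall>ys\<in>P. xs \<noteq> ys \<longrightarrow> set xs \<inter> set ys = {}) \<and>
     \<Union> (set ` P) = A"
proof
  assume "P \<in> list_partitions A"
  then have P: "\<forall>xs\<in>P. distinct xs" "inj_on set P" "partition_on A (set ` P)"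
    by (auto simp: list_partitions_def)
  have "xs \<noteq> []" if "xs \<in> P" for xs
    using P(3) that unfolding partition_on_def by (metis imageI set_empty)
  moreover have "set xs \<inter> set ys = {}" if "xs \<in> P" "ys \<in> P" "xs \<noteq> ys" for xs ys
    using P(2,3) that unfolding partition_on_def
    by (meson disjointD imageI inj_onD)
  ultimately show "(\<forall>xs\<in>P. distinct xs \<and> xs \<noteq> []) \<and>
     (\<forall>xs\<in>P. \<forall>ys\<in>P. xs \<noteq> ys \<longrightarrow> set xs \<inter> set ys = {}) \<and> \<Union> (set ` P) = A"
    using P unfolding partition_on_def by blast
next
  assume "(\<forall>xs\<in>P. distinct xs \<and> xs \<noteq> []) \<and>
     (\<forall>xs\<in>P. \<forall>ys\<in>P. xs \<noteq> ys \<longrightarrow> set xs \<inter> set ys = {}) \<and> \<Union> (set ` P) = A"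
  then have P: "\<And>xs. xs \<in> P \<Longrightarrow> distinct xs" "\<And>xs. xs \<in> P \<Longrightarrow> xs \<noteq> []"
    "\<And>xs ys. xs \<in> P \<Longrightarrow> ys \<in> P \<Longrightarrow> xs \<noteq> ys \<Longrightarrow> set xs \<inter> set ys = {}"
    "\<Union> (set ` P) = A"
    by simp_all
  have "inj_on set P"
    by (rule inj_onI) (metis P(2,3) Int_absorb set_empty)
  moreover have "disjoint (set ` P)"
  proof (rule disjointI)
    fix p q assume "p \<in> set ` P" "q \<in> set ` P" "p \<noteq> q"
    then obtain xs ys where "xs \<in> P" "ys \<in> P" "p = set xs" "q = set ys" "xs \<noteq> ys"
      by blast
    then show "p \<inter> q = {}" using P(3) by simp
  qed
  moreover have "{} \<notin> set ` P"
    using P(2) by auto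
  ultimately show "P \<in> list_partitions A"
    using P(1,4) by (simp add: list_partitions_def partition_on_def)
qed

lemma list_partitionsI:
  assumes "\<And>xs. xs \<in> P \<Longrightarrow> distinct xs" "[] \<notin> P"
    and "\<And>xs ys. xs \<in> P \<Longrightarrow> ys \<in> P \<Longrightarrow> xs \<noteq> ys \<Longrightarrow> set xs \<inter> set ys = {}"
    and "\<Union> (set ` P) = A"
  shows "P \<in> list_partitions A"
  unfolding list_partitions_iff using assms by (intro conjI ballI impI) (simp_all, metis)

lemma list_partitionsD:
  assumes "P \<in> list_partitions A"
  shows "xs \<in> P \<Longrightarrow> distinct xs" "[] \<notin> P" "xs \<in> P \<Longrightarrow> set xs \<subseteq> A"
    and "xs \<in> P \<Longrightarrow> ys \<in> P \<Longrightarrow> xs \<noteq> ys \<Longrightarrow> set xs \<inter> set ys = {}"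
    and "\<Union> (set ` P) = A"
  using assms by (simp_all add: list_partitions_iff) blast+

lemma list_partitions_subset:
  assumes "P \<in> list_partitions A"
  shows "P \<subseteq> {xs. set xs \<subseteq> A \<and> distinct xs}"
  using list_partitionsD(1,3)[OF assms] by blast

lemma finite_list_partitions:
  assumes "finite A"
  shows "finite (list_partitions A)"
proof (rule finite_subset)
  show "list_partitions A \<subseteq> Pow {xs. set xs \<subseteq> A \<and> distinct xs}"
    using list_partitions_subset by blast
  show "finite (Pow {xs. set xs \<subseteq> A \<and> distinct xs})"
    using finite_subset_distinct[OF assms] by simp
qed

lemma card_list_partition_le:
  assumes "finite A" "P \<in> list_partitions A"
  shows "card P \<le> card A"
proof (rule card_inj_on_le)
  note P = list_partitionsD[OF assms(2)]
  show "inj_on hd P"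
    by (rule inj_onI) (metis P(2,4) disjoint_iff list.set_sel(1))
  show "hd ` P \<subseteq> A"
    using P(2,3) list.set_sel(1) by (metis image_subsetI subsetD)
qed (fact assms(1))

lemma card_list_partitions_bij_le:
  assumes "finite A" "bij_betw f A A'"
  shows "card (list_partitions A) \<le> card (list_partitions A')"
proof (rule card_inj_on_le)
  let ?F = "\<lambda>P. map f ` P"
  have inj: "inj_on f A" and im: "f ` A = A'"
    using assms(2) by (auto simp: bij_betw_def)
  have inj_map: "inj_on (map f) {xs. set xs \<subseteq> A \<and> distinct xs}"
  proof (rule inj_onI)
    fix xs ys assume "xs \<in> {xs. set xs \<subseteq> A \<and> distinct xs}"
      "ys \<in> {xs. set xs \<subseteq> A \<and> distinct xs}" and eq: "map f xs = map f ys"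
    then have "set xs \<union> set ys \<subseteq> A" by simp
    from map_inj_on[OF eq inj_on_subset[OF inj this]] show "xs = ys" .
  qed
  show "inj_on ?F (list_partitions A)"
  proof (rule inj_onI)
    fix P Q assume "P \<in> list_partitions A" "Q \<in> list_partitions A" "map f ` P = map f ` Q"
    then show "P = Q"
      using inj_on_image_eq_iff[OF inj_map list_partitions_subset list_partitions_subset] by blast
  qed
  show "?F ` list_partitions A \<subseteq> list_partitions A'"
  proof
    fix Q assume "Q \<in> ?F ` list_partitions A"
    then obtain P where Q: "Q = map f ` P" and PA: "P \<in> list_partitions A" by blast
    note P = list_partitionsD[OF PA]
    show "Q \<in> list_partitions A'"
    proof (rule list_partitionsI)
      fix us assume "us \<in> Q"
      then obtain xs where xs: "xs \<in> P" "us = map f xs" using Q by blast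
      then show "distinct us"
        using P(1) inj_on_subset[OF inj P(3)] by (simp add: distinct_map)
      fix vs assume "vs \<in> Q" "us \<noteq> vs"
      then obtain ys where ys: "ys \<in> P" "vs = map f ys" "xs \<noteq> ys" using Q xs by blast
      have "set xs \<inter> set ys = {}" using P(4) xs ys by simp
      then show "set us \<inter> set vs = {}"
        using inj_on_image_Int[OF inj P(3) P(3), OF xs(1) ys(1)] xs(2) ys(2) by simp
    next
      show "[] \<notin> Q" using P(2) by (auto simp: Q)
      have "\<Union> (set ` Q) = f ` \<Union> (set ` P)" by (simp add: Q image_UN)
      then show "\<Union> (set ` Q) = A'" using P(5) im by simp
    qed
  qed
  show "finite (list_partitions A')"
    using assms finite_list_partitions bij_betw_finite by blast
qed

lemma card_list_partitions_cong:
  assumes "finite A" "finite A'" "card A = card A'"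
  shows "card (list_partitions A) = card (list_partitions A')"
proof (rule antisym)
  obtain f where f: "bij_betw f A A'"
    using assms finite_same_card_bij by blast
  show "card (list_partitions A) \<le> card (list_partitions A')"
    using card_list_partitions_bij_le[OF assms(1) f] .
  show "card (list_partitions A') \<le> card (list_partitions A)"
    using card_list_partitions_bij_le[OF assms(2) bij_betw_inv_into[OF f]] .
qed

text \<open>
  At \<open>n = 0\<close> the two sides are \<open>0\<close> and \<open>1\<close>: the empty set has the empty partition, which the
  sum over \<open>k \<ge> 1\<close> leaves out.
\<close>
lemma lah_total_eq_card_list_partitions:
  assumes "n \<ge> 1"
  shows "lah_total n = card (list_partitions {1..n})"
proof -
  have "list_partitions {1..n} = (\<Union>k\<in>{1..n}. ordered_block_partitions {1..n} k)"
    (is "_ = ?U")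
  proof (rule set_eqI)
    fix P
    have "card P \<in> {1..n}" if P: "P \<in> list_partitions {1..n}"
    proof -
      have "finite P"
        using list_partitions_subset[OF P] finite_subset_distinct[of "{1..n}"]
        by (auto intro: finite_subset)
      moreover have "P \<noteq> {}"
        using list_partitionsD(5)[OF P] assms by auto
      ultimately show ?thesis
        using card_list_partition_le[OF _ P] by (simp add: Suc_le_eq card_gt_0_iff)
    qed
    then show "P \<in> list_partitions {1..n} \<longleftrightarrow> P \<in> ?U"
      by (auto simp: list_partitions_def ordered_block_partitions_def)
  qed
  moreover have "card ?U = (\<Sum>k\<in>{1..n}. card (ordered_block_partitions {1..n} k))"
  proof (rule card_UN_disjoint)
    show "\<forall>k\<in>{1..n}. finite (ordered_block_partitions {1..n} k)"
      using finite_list_partitions[of "{1..n}"]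
      by (auto simp: list_partitions_def ordered_block_partitions_def
               intro: rev_finite_subset)
  qed (auto simp: ordered_block_partitions_def)
  ultimately show ?thesis
    by (simp add: lah_total_def lah_def)
qed

section \<open>Excluding singleton blocks\<close>

definition no_singletons :: "'a set \<Rightarrow> 'a set \<Rightarrow> 'a list set set" where
  "no_singletons A B = {P \<in> list_partitions A. \<forall>b\<in>B. [b] \<notin> P}"

text \<open>
  Deleting the block \<open>[b]\<close> is a bijection onto the partitions of \<open>A - {b}\<close>; since \<open>b \<notin> B\<close>, the
  condition on \<open>B\<close> does not see the deleted block.
\<close>
lemma card_with_singleton:
  assumes "b \<in> A" "b \<notin> B"
  shows "card {P \<in> no_singletons A B. [b] \<in> P} = card (no_singletons (A - {b}) B)"
proof (rule bij_betw_same_card[OF bij_betw_byWitness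
      [where f = "\<lambda>P. P - {[b]}" and f' = "insert [b]"]])
  let ?S = "{P \<in> no_singletons A B. [b] \<in> P}"
  let ?T = "no_singletons (A - {b}) B"
  have not_in: "[b] \<notin> P" if "P \<in> ?T" for P
    using that list_partitionsD(3)[of P "A - {b}" "[b]"] by (auto simp: no_singletons_def)
  show "\<forall>P\<in>?S. insert [b] (P - {[b]}) = P" by blast
  show "\<forall>P\<in>?T. insert [b] P - {[b]} = P" using not_in by blast
  show "(\<lambda>P. P - {[b]}) ` ?S \<subseteq> ?T"
  proof (rule image_subsetI)
    fix P assume "P \<in> ?S"
    then have PA: "P \<in> list_partitions A" and PB: "\<forall>c\<in>B. [c] \<notin> P" and bP: "[b] \<in> P"
      by (auto simp: no_singletons_def)
    note P = list_partitionsD[OF PA]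
    have nb: "b \<notin> set xs" if "xs \<in> P - {[b]}" for xs
      using P(4)[of xs "[b]"] bP that by auto
    have "P - {[b]} \<in> list_partitions (A - {b})"
    proof (rule list_partitionsI)
      have "\<Union> (set ` P) = insert b (\<Union> (set ` (P - {[b]})))" using bP by force
      moreover have "b \<notin> \<Union> (set ` (P - {[b]}))" using nb by blast
      ultimately show "\<Union> (set ` (P - {[b]})) = A - {b}" using P(5) by simp
    qed (use P(1,2,4) in simp_all)
    then show "P - {[b]} \<in> ?T" using PB by (simp add: no_singletons_def)
  qed
  show "insert [b] ` ?T \<subseteq> ?S"
  proof (rule image_subsetI)
    fix P assume "P \<in> ?T"
    then have PA: "P \<in> list_partitions (A - {b})" and PB: "\<forall>c\<in>B. [c] \<notin> P"
      by (auto simp: no_singletons_def)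
    note P = list_partitionsD[OF PA]
    have nb: "b \<notin> set xs" if "xs \<in> P" for xs using P(3)[OF that] by blast
    have "insert [b] P \<in> list_partitions A"
    proof (rule list_partitionsI)
      show "set xs \<inter> set ys = {}"
        if "xs \<in> insert [b] P" "ys \<in> insert [b] P" "xs \<noteq> ys" for xs ys
        using that P(4)[of xs ys] nb by auto
      show "\<Union> (set ` insert [b] P) = A" using P(5) assms(1) by auto
    qed (use P(1,2) in auto)
    then show "insert [b] P \<in> ?S" using PB assms(2) by (auto simp: no_singletons_def)
  qed
qed

lemma card_no_singletons_insert:
  assumes "finite A" "b \<in> A" "b \<notin> B"
  shows "card (no_singletons A B) =
         card (no_singletons A (insert b B)) + card (no_singletons (A - {b}) B)"
proof -
  have "no_singletons A B =
        no_singletons A (insert b B) \<union> {P \<in> no_singletons A B. [b] \<in> P}"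
    by (auto simp: no_singletons_def)
  moreover have "finite (no_singletons A B)" "finite (no_singletons A (insert b B))"
    using finite_list_partitions[OF assms(1)] by (auto simp: no_singletons_def)
  moreover have "no_singletons A (insert b B) \<inter> {P \<in> no_singletons A B. [b] \<in> P} = {}"
    by (auto simp: no_singletons_def)
  ultimately show ?thesis
    using card_with_singleton[OF assms(2,3)]
    by (metis (no_types, lifting) card_Un_disjoint finite_Un)
qed

section \<open>Differences count partitions\<close>

text \<open>
  By Pascal's rule, the coefficients of \<open>\<Delta>\<^sup>k\<^sup>+\<^sup>1\<close> split into those of \<open>\<Delta>\<^sup>k\<close> at \<open>n + 1\<close> and,
  after an index shift, those of \<open>- \<Delta>\<^sup>k\<close> at \<open>n\<close>.
\<close>
lemma seq_diff_Suc: "seq_diff (Suc k) \<mu> n = seq_diff k \<mu> (Suc n) - seq_diff k \<mu> n"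
proof -
  let ?c = "\<lambda>j m. (-1) ^ m * real (j choose m)"
  have shift: "(\<Sum>m\<le>k. ?c k (Suc m) * \<mu> (n + k - m)) =
        (\<Sum>m\<le>k. ?c k m * \<mu> (Suc n + k - m)) - \<mu> (Suc n + k)"
  proof -
    have "(\<Sum>m\<le>k. ?c k m * \<mu> (Suc n + k - m)) =
          (\<Sum>m\<le>Suc k. ?c k m * \<mu> (Suc n + k - m))"
      by simp
    also have "\<dots> = \<mu> (Suc n + k) + (\<Sum>m\<le>k. ?c k (Suc m) * \<mu> (n + k - m))"
      by (subst sum.atMost_Suc_shift) simp
    finally show ?thesis by simp
  qed
  have "seq_diff (Suc k) \<mu> n = \<mu> (Suc n + k) + (\<Sum>m\<le>k. ?c (Suc k) (Suc m) * \<mu> (n + k - m))"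
    unfolding seq_diff_def atMost_atLeast0[symmetric]
    by (subst sum.atMost_Suc_shift) simp
  also have "(\<Sum>m\<le>k. ?c (Suc k) (Suc m) * \<mu> (n + k - m)) =
      (\<Sum>m\<le>k. ?c k (Suc m) * \<mu> (n + k - m)) - (\<Sum>m\<le>k. ?c k m * \<mu> (n + k - m))"
    unfolding sum_subtractf[symmetric] by (rule sum.cong) (auto simp: algebra_simps)
  finally show ?thesis
    unfolding shift by (simp add: seq_diff_def atMost_atLeast0)
qed

text \<open>
  Adding an element \<open>b\<close> to \<open>B\<close> lowers \<open>card A - card B\<close> by one and raises the order of the
  difference; removing \<open>b\<close> from \<open>A\<close> lowers the index at the same order. The counting recursion
  is therefore the recursion of the differences. The induction has to range over all \<open>A\<close>, and
  \<open>B \<subset> A\<close> keeps the index of the sequence positive throughout.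
\<close>
lemma card_no_singletons_eq_seq_diff:
  assumes "finite A" "B \<subset> A"
  shows "real (card (no_singletons A B)) =
         seq_diff (card B) (\<lambda>n. real (lah_total n)) (card A - card B)"
proof -
  have "finite B" using assms finite_subset by blast
  then show ?thesis using assms
  proof (induction B arbitrary: A rule: finite_induct)
    case empty
    then have "lah_total (card A) = card (list_partitions {1..card A})"
      by (intro lah_total_eq_card_list_partitions) (simp add: Suc_le_eq card_gt_0_iff psubset_eq)
    also have "\<dots> = card (list_partitions A)"
      using empty by (intro card_list_partitions_cong) auto
    finally show ?case by (simp add: no_singletons_def seq_diff_def)
  next
    case (insert b B)
    let ?L = "\<lambda>n. real (lah_total n)"
    have "card (insert b B) < card A"
      using insert.prems psubset_card_mono by blast
    then have less: "Suc (card B) < card A" using insert.hyps by simp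
    have b: "b \<in> A" "b \<notin> B" using insert by auto
    have "B \<subset> A" "B \<subset> A - {b}" using insert.prems insert.hyps by auto
    then have "real (card (no_singletons A B)) = seq_diff (card B) ?L (card A - card B)"
      "real (card (no_singletons (A - {b}) B)) =
         seq_diff (card B) ?L (card (A - {b}) - card B)"
      using insert.IH insert.prems by auto
    moreover have "card A - card B = Suc (card A - Suc (card B))"
      "card (A - {b}) - card B = card A - Suc (card B)"
      using less b insert.prems by (auto simp: card_Diff_singleton)
    ultimately show ?case
      using card_no_singletons_insert[OF insert.prems(1) b] insert.hyps
      by (simp add: seq_diff_Suc)
  qed
qed

lemma seq_diff_lah_total_nonneg:
  assumes "n \<ge> 1"
  shows "seq_diff k (\<lambda>n. real (lah_total n)) n \<ge> 0"
proof -
  have "{1..k} \<subset> {1..n + k}" using assms by auto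
  from card_no_singletons_eq_seq_diff[OF _ this]
  have "seq_diff k (\<lambda>n. real (lah_total n)) n = real (card (no_singletons {1..n + k} {1..k}))"
    by simp
  then show ?thesis by simp
qed

theorem theorem3p1:
  shows "absolutely_convex (\<lambda>n. real (lah_total n)) \<and>
         (\<forall>n\<ge>1. real (lah_total (n + 2)) - 2 * real (lah_total (n + 1)) + real (lah_total n) \<ge> 0)"
proof (intro conjI allI impI)
  show "absolutely_convex (\<lambda>n. real (lah_total n))"
    using seq_diff_lah_total_nonneg by (simp add: absolutely_convex_def)
next
  fix n :: nat assume "n \<ge> 1"
  then have "seq_diff 2 (\<lambda>n. real (lah_total n)) n \<ge> 0"
    by (rule seq_diff_lah_total_nonneg)
  moreover have "seq_diff 2 (\<lambda>n. real (lah_total n)) n =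
      real (lah_total (n + 2)) - 2 * real (lah_total (n + 1)) + real (lah_total n)"
    by (simp add: numeral_2_eq_2 seq_diff_Suc) (simp add: seq_diff_def)
  ultimately show "real (lah_total (n + 2)) - 2 * real (lah_total (n + 1)) + real (lah_total n) \<ge> 0"
    by simp
qed

end
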